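(* Let $m,n$ be positive integers such that either $m=1$ and $n=2$, or $m\geqslant 2$ and $n=1$. Then for almost all pairs $(\Theta,\Theta')$ of real $m\times n$ matrices (with respect to Lebesgue measure on $\mathbb{R}^{m\times n}\times\mathbb{R}^{m\times n}$) the difference function $\psi_\Theta(t)-\psi_{\Theta'}(t)$ changes its sign infinitely many times as $t\to+\infty$; that is, for every $T>0$ there exist $t_1,t_2>T$ with $\psi_\Theta(t_1)-\psi_{\Theta'}(t_1)>0$ and $\psi_\Theta(t_2)-\psi_{\Theta'}(t_2)<0$.
   Context: For a real $m\times n$ matrix $\Theta=(\theta^i_j)_{1\leqslant j\leqslant m,\,1\leqslant i\leqslant n}$ (row index $j$, column index $i$) the irrationality measure function is defined for real $t\geqslant 1$ by $$\psi_\Theta(t)=\min_{\substack{(x_1,\ldots,x_n)\in\mathbb{Z}^n\\ 1\leqslant\max_{1\leqslant i\leqslant n}|x_i|\leqslant t}}\ \max_{1\leqslant j\leqslant m}\|\theta^1_jx_1+\ldots+\theta^n_jx_n\|,$$ where $\|\cdot\|$ denotes the distance to the nearest integer. *)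

theory Defs
  imports "HOL-Analysis.Analysis"
begin

definition dist_nearest_int :: "real \<Rightarrow> real" where
  "dist_nearest_int y = \<bar>y - of_int (round y)\<bar>"

definition int_sup_norm :: "int ^ 'n::finite \<Rightarrow> int" where
  "int_sup_norm x = (MAX i. \<bar>x $ i\<bar>)"

definition admissible :: "real \<Rightarrow> (int ^ 'n::finite) set" where
  "admissible t = {x. 1 \<le> int_sup_norm x \<and> real_of_int (int_sup_norm x) \<le> t}"

(* An m x n matrix has type real ^ 'n ^ 'm, so \<Theta> $ j $ i is the entry in row j and column i.
   Only the values at t \<ge> 1 are meaningful: for t < 1 the set of admissible x is empty and
   Min is unspecified. *)
definition irr_measure :: "real ^ 'n::finite ^ 'm::finite \<Rightarrow> real \<Rightarrow> real" where
  "irr_measure \<Theta> t =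
     Min ((\<lambda>x::int ^ 'n. MAX j. dist_nearest_int (\<Sum>i\<in>UNIV. \<Theta> $ j $ i * real_of_int (x $ i)))
       ` admissible t)"

lemma finite_admissible: "finite (admissible t :: (int ^ 'n::finite) set)"
proof -
  have "admissible t \<subseteq> vec_lambda ` (UNIV \<rightarrow>\<^sub>E {-\<lfloor>t\<rfloor>..\<lfloor>t\<rfloor>} :: ('n \<Rightarrow> int) set)"
  proof
    fix x :: "int ^ 'n"
    assume "x \<in> admissible t"
    then have le: "int_sup_norm x \<le> \<lfloor>t\<rfloor>"
      by (simp add: admissible_def le_floor_iff)
    have "\<bar>x $ i\<bar> \<le> \<lfloor>t\<rfloor>" for i
    proof -
      have "\<bar>x $ i\<bar> \<le> int_sup_norm x"
        unfolding int_sup_norm_def by (rule Max_ge) auto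
      with le show ?thesis by linarith
    qed
    then have "vec_nth x \<in> UNIV \<rightarrow>\<^sub>E {-\<lfloor>t\<rfloor>..\<lfloor>t\<rfloor>}"
      by (auto simp: PiE_def Pi_def abs_le_iff minus_le_iff)
    then show "x \<in> vec_lambda ` (UNIV \<rightarrow>\<^sub>E {-\<lfloor>t\<rfloor>..\<lfloor>t\<rfloor>})"
      by (intro image_eqI[of _ _ "vec_nth x"]) auto
  qed
  then show ?thesis
    by (rule finite_subset) (auto intro!: finite_imageI finite_PiE)
qed

lemma admissible_nonempty:
  assumes "1 \<le> t"
  shows "(admissible t :: (int ^ 'n::finite) set) \<noteq> {}"
proof -
  have "int_sup_norm ((\<chi> i. 1) :: int ^ 'n) = 1"
    by (simp add: int_sup_norm_def)
  with assms have "((\<chi> i. 1) :: int ^ 'n) \<in> admissible t"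
    by (simp add: admissible_def)
  then show ?thesis by blast
qed

end

theory Submission
  imports Defs
begin

text \<open>
  Write \<open>m\<close> and \<open>n\<close> for the numbers of rows and columns. At the heights \<open>t = k ^ m\<close> Dirichlet's
  theorem bounds the irrationality measure function by \<open>1 / k ^ n\<close>. Sign changes of the difference
  occur because, for almost all pairs, each of the two functions is infinitely often above
  \<open>a / k ^ n\<close> at a height where the other one is below \<open>a / k ^ n\<close>. Two facts yield this.

  First, almost every \<open>\<Theta>\<close> is not singular: there is a constant \<open>0 < a \<le> 1\<close>, depending on \<open>\<Theta>\<close>, such that
  the function of \<open>\<Theta>\<close> exceeds \<open>a / k ^ n\<close> for infinitely many \<open>k\<close>
  (\<open>AE_irr_measure_gt_infinitely_often\<close>). In a fixed ball, the matrices that have a nonzero integer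
  vector of height at most \<open>k ^ m\<close> with error at most \<open>a / k ^ n\<close> have measure \<open>O(a ^ m)\<close>, uniformly
  in \<open>k\<close> (\<open>measure_small_irr_measure_le\<close>).

  Secondly, whatever the infinite set \<open>K\<close> and the constant \<open>0 < a \<le> 1\<close> are, almost every \<open>\<Theta>'\<close> has a
  function that is at most \<open>a / k ^ n\<close> for infinitely many \<open>k \<in> K\<close>
  (\<open>AE_irr_measure_le_infinitely_often\<close>). Dirichlet's theorem gives error \<open>1 / k ^ n\<close>, and a
  perturbation within a ball of radius \<open>d\<close> around \<open>\<Theta>'\<close>, for a suitable small \<open>d\<close>, achieves the
  smaller error on a ball of radius proportional to \<open>d\<close> (\<open>ball_of_small_irr_measure\<close>). Hence the
  exceptional set is porous, and porous sets are null sets (\<open>porous_negligible\<close>).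

  Choosing \<open>K\<close> as the set of those \<open>k\<close> at which the function of \<open>\<Theta>\<close> exceeds \<open>a / k ^ n\<close>, Fubini's
  theorem gives the claim for almost all pairs; exchanging the matrices gives the other sign.
\<close>

section \<open>Values of the linear forms\<close>

abbreviation lin_form :: "real ^ 'n::finite ^ 'm::finite \<Rightarrow> int ^ 'n \<Rightarrow> 'm \<Rightarrow> real" where
  "lin_form \<Theta> x j \<equiv> \<Sum>i\<in>UNIV. \<Theta> $ j $ i * real_of_int (x $ i)"

lemma lin_form_diff: "lin_form (\<Theta> - \<Phi>) x j = lin_form \<Theta> x j - lin_form \<Phi> x j"
  by (simp add: algebra_simps sum_subtractf)

lemma lin_form_add_column:
  "lin_form (\<Theta> + (\<chi> j. axis i (v j))) x j = lin_form \<Theta> x j + v j * of_int (x $ i)"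
proof -
  have "(\<Sum>l\<in>UNIV. axis i (v j) $ l * real_of_int (x $ l)) =
        (\<Sum>l\<in>UNIV. if l = i then v j * real_of_int (x $ i) else 0)"
    by (intro sum.cong) (auto simp: axis_def)
  then show ?thesis
    by (simp add: algebra_simps sum.distrib)
qed

lemma norm_axis_real: "norm (axis i v :: real ^ 'n::finite) = \<bar>v\<bar>"
  by (simp add: norm_eq_sqrt_inner inner_axis_axis)

lemma norm_column_le:
  fixes b :: real
  assumes "\<And>j. \<bar>v j\<bar> \<le> b"
  shows "norm ((\<chi> j. axis i (v j)) :: real ^ 'n::finite ^ 'm::finite) \<le> real CARD('m) * b"
proof -
  have "norm ((\<chi> j. axis i (v j)) :: real ^ 'n ^ 'm) \<le> (\<Sum>j\<in>(UNIV :: 'm set). \<bar>v j\<bar>)"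
    unfolding norm_vec_def[of "\<chi> j. axis i (v j)"] by (rule order_trans[OF L2_set_le_sum]) (auto simp: norm_axis_real)
  also have "\<dots> \<le> (\<Sum>j\<in>(UNIV :: 'm set). b)" by (intro sum_mono assms)
  finally show ?thesis by simp
qed

lemma abs_le_int_sup_norm: "\<bar>x $ i\<bar> \<le> int_sup_norm x"
  unfolding int_sup_norm_def by (rule Max_ge) auto

lemma int_sup_norm_attained: "\<exists>i. \<bar>x $ i\<bar> = int_sup_norm x"
proof -
  have "int_sup_norm x \<in> range (\<lambda>i. \<bar>x $ i\<bar>)"
    unfolding int_sup_norm_def by (rule Max_in) auto
  then show ?thesis by auto
qed

lemma abs_lin_form_le:
  fixes \<Theta> :: "real ^ 'n::finite ^ 'm::finite"
  shows "\<bar>lin_form \<Theta> x j\<bar> \<le> CARD('n) * (norm \<Theta> * real_of_int (int_sup_norm x))"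
proof -
  have "\<bar>lin_form \<Theta> x j\<bar> \<le> (\<Sum>i\<in>UNIV. \<bar>\<Theta> $ j $ i * real_of_int (x $ i)\<bar>)" by (rule sum_abs)
  also have "\<dots> \<le> (\<Sum>i\<in>(UNIV :: 'n set). norm \<Theta> * real_of_int (int_sup_norm x))"
  proof (rule sum_mono)
    fix i
    have "\<bar>\<Theta> $ j $ i\<bar> \<le> norm \<Theta>"
      using component_le_norm_cart[of "\<Theta> $ j" i] Finite_Cartesian_Product.norm_nth_le[of \<Theta> j] by linarith
    moreover have "\<bar>real_of_int (x $ i)\<bar> \<le> real_of_int (int_sup_norm x)"
      using abs_le_int_sup_norm[of x i] by linarith
    ultimately show "\<bar>\<Theta> $ j $ i * real_of_int (x $ i)\<bar> \<le> norm \<Theta> * real_of_int (int_sup_norm x)"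
      by (simp add: abs_mult mult_mono)
  qed
  finally show ?thesis by simp
qed

lemma dist_nearest_int_le: "dist_nearest_int y \<le> \<bar>y - of_int z\<bar>"
  unfolding dist_nearest_int_def by (rule round_diff_minimal)

section \<open>Level sets and measurability of the irrationality measure function\<close>

lemma irr_measure_le_iff:
  fixes \<Theta> :: "real ^ 'n::finite ^ 'm::finite"
  assumes "1 \<le> t"
  shows "irr_measure \<Theta> t \<le> d \<longleftrightarrow>
    (\<exists>x\<in>admissible t. \<forall>j. dist_nearest_int (lin_form \<Theta> x j) \<le> d)"
  unfolding irr_measure_def
  using finite_admissible[of t] admissible_nonempty[OF assms]
  by (subst Min_le_iff) auto

lemma borel_measurable_dist_lin_form [measurable]:
  "(\<lambda>\<Theta> :: real ^ 'n::finite ^ 'm::finite. dist_nearest_int (lin_form \<Theta> x j)) \<in> borel_measurable borel"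
proof -
  have [measurable]: "(\<lambda>\<Theta> :: real ^ 'n ^ 'm. lin_form \<Theta> x j) \<in> borel_measurable borel"
    by (intro borel_measurable_continuous_onI continuous_intros)
  have [measurable]: "dist_nearest_int \<in> borel_measurable borel"
    unfolding dist_nearest_int_def round_def by measurable
  show ?thesis by measurable
qed

lemma borel_measurable_irr_measure:
  assumes "1 \<le> t"
  shows "(\<lambda>\<Theta> :: real ^ 'n::finite ^ 'm::finite. irr_measure \<Theta> t) \<in> borel_measurable borel"
proof (rule borel_measurableI_le)
  fix d
  have "{\<Theta> :: real ^ 'n ^ 'm. irr_measure \<Theta> t \<le> d} =
     (\<Union>x\<in>admissible t. \<Inter>j. {\<Theta>. dist_nearest_int (lin_form \<Theta> x j) \<le> d})"
    by (auto simp: irr_measure_le_iff[OF assms])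
  also have "\<dots> \<in> sets borel"
    by (rule sets.finite_UN[OF finite_admissible], rule sets.finite_INT) auto
  finally show "{\<Theta> \<in> space borel. irr_measure (\<Theta> :: real ^ 'n ^ 'm) t \<le> d} \<in> sets borel"
    by simp
qed

lemma borel_measurable_irr_measure_power [measurable]:
  "(\<lambda>\<Theta> :: real ^ 'n::finite ^ 'm::finite. irr_measure \<Theta> (real (Suc k ^ CARD('m)))) \<in> borel_measurable borel"
  by (rule borel_measurable_irr_measure) (simp add: one_le_power)

section \<open>Small values along a prescribed sequence of heights\<close>

text \<open>
  Dirichlet's theorem for \<open>m\<close> linear forms in \<open>n\<close> variables. Heights of the form \<open>k ^ m\<close> turn
  the bound \<open>t powr (- n / m)\<close> into \<open>1 / k ^ n\<close>, and make the pigeonhole count exact.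
\<close>
lemma dirichlet_linear_forms:
  fixes \<Theta> :: "real ^ 'n::finite ^ 'm::finite"
  assumes "k > 0"
  shows "\<exists>x\<in>admissible (real (k ^ CARD('m))). \<forall>j. dist_nearest_int (lin_form \<Theta> x j) \<le> 1 / real k ^ CARD('n)"
proof -
  \<comment> \<open>Pigeonhole: \<open>(H + 1) ^ n\<close> integer vectors are sorted into the \<open>N ^ m = H ^ n\<close> cells
    of side \<open>1 / N\<close> of the unit cube of fractional parts.\<close>
  define H where "H = k ^ CARD('m)"
  define N where "N = k ^ CARD('n)"
  have N: "N > 0" using assms by (simp add: N_def)
  define L where "L x j = lin_form \<Theta> (vec_lambda x) j" for x :: "'n \<Rightarrow> int" and j
  define A :: "('n \<Rightarrow> int) set" where "A = (UNIV \<rightarrow>\<^sub>E {0..int H})"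
  define B :: "('m \<Rightarrow> int) set" where "B = (UNIV \<rightarrow>\<^sub>E {0..<int N})"
  define f where "f x = (\<lambda>j. \<lfloor>frac (L x j) * N\<rfloor>)" for x
  have "f ` A \<subseteq> B"
    using N by (auto simp: f_def B_def PiE_def floor_less_iff frac_lt_1)
  moreover have "finite B" by (auto simp: B_def intro!: finite_PiE)
  ultimately have "card (f ` A) \<le> card B" by (rule card_mono[rotated])
  also have "card B = N ^ CARD('m)" by (simp add: B_def card_PiE)
  also have "\<dots> = H ^ CARD('n)" by (simp add: N_def H_def mult.commute flip: power_mult)
  also have "\<dots> < (H + 1) ^ CARD('n)" by (rule power_strict_mono) auto
  also have "\<dots> = card A" by (simp add: A_def card_PiE nat_add_distrib)
  finally obtain u v where uv: "u \<in> A" "v \<in> A" "u \<noteq> v" "f u = f v"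
    using pigeonhole[of f A] by (auto simp: inj_on_def)
  define x :: "int ^ 'n" where "x = (\<chi> i. u i - v i)"
  have "x \<noteq> 0" using uv(3) by (auto simp: x_def vec_eq_iff)
  then obtain i0 where "x $ i0 \<noteq> 0" by (auto simp: vec_eq_iff)
  then have "1 \<le> int_sup_norm x" using abs_le_int_sup_norm[of x i0] by linarith
  moreover have "int_sup_norm x \<le> int H"
  proof -
    obtain i where "\<bar>x $ i\<bar> = int_sup_norm x" using int_sup_norm_attained by blast
    moreover have "0 \<le> u i" "u i \<le> H" "0 \<le> v i" "v i \<le> H"
      using uv(1,2) by (auto simp: A_def PiE_def Pi_def)
    ultimately show ?thesis by (simp add: x_def)
  qed
  ultimately have "x \<in> admissible (real H)" by (simp add: admissible_def)
  moreover have "dist_nearest_int (lin_form \<Theta> x j) \<le> 1 / real N" for j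
  proof -
    have "lin_form \<Theta> x j = L u j - L v j"
      by (simp add: x_def L_def algebra_simps sum_subtractf)
    then have eq: "lin_form \<Theta> x j - of_int (\<lfloor>L u j\<rfloor> - \<lfloor>L v j\<rfloor>) = frac (L u j) - frac (L v j)"
      by (simp add: frac_def)
    have "\<lfloor>frac (L u j) * N\<rfloor> = \<lfloor>frac (L v j) * N\<rfloor>"
      using uv(4) by (auto simp: f_def fun_eq_iff)
    then have "\<bar>frac (L u j) * N - frac (L v j) * N\<bar> \<le> 1"
      by linarith
    then have "\<bar>frac (L u j) - frac (L v j)\<bar> * N \<le> 1"
      by (simp add: abs_mult flip: left_diff_distrib)
    then have "\<bar>frac (L u j) - frac (L v j)\<bar> \<le> 1 / N"
      using N by (simp add: field_simps)
    then show ?thesis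
      using dist_nearest_int_le[of "lin_form \<Theta> x j" "\<lfloor>L u j\<rfloor> - \<lfloor>L v j\<rfloor>"] unfolding eq by linarith
  qed
  ultimately show ?thesis by (auto simp: H_def N_def)
qed

text \<open>
  The local form of Dirichlet's theorem with an arbitrarily small constant \<open>a\<close>: although
  \<open>\<Theta>\<close> itself need not admit a solution with error \<open>a / k ^ n\<close>, a solution \<open>x\<close> of height \<open>h\<close> with
  error \<open>1 / k ^ n\<close> becomes exact after a perturbation of size about \<open>1 / (k ^ n * h)\<close>, and it
  keeps error \<open>a / k ^ n\<close> on a ball of radius proportional to that size. The scale \<open>d\<close> depends on
  \<open>\<Theta>\<close> through \<open>h\<close>, but the proportion does not.
\<close>
lemma ball_of_small_irr_measure:
  fixes \<Theta> :: "real ^ 'n::finite ^ 'm::finite"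
  assumes k: "k > 0" and a: "0 < a" "a \<le> 1"
  shows "\<exists>d \<Phi>. 0 < d \<and> d \<le> real (CARD('m) + 1) / real k ^ CARD('n) \<and>
    ball \<Phi> (a / (CARD('n) * real (CARD('m) + 1)) * d) \<subseteq>
    ball \<Theta> d \<inter> {\<Psi>. irr_measure \<Psi> (real (k ^ CARD('m))) \<le> a / real k ^ CARD('n)}"
proof -
  define e where "e = 1 / real k ^ CARD('n)"
  have e: "e > 0" using k by (simp add: e_def)
  have t1: "1 \<le> real (k ^ CARD('m))" using k by simp
  obtain x where x: "x \<in> admissible (real (k ^ CARD('m)))"
    "\<And>j. dist_nearest_int (lin_form \<Theta> x j) \<le> e"
    using dirichlet_linear_forms[OF k, of \<Theta>] unfolding e_def by blast
  define h where "h = real_of_int (int_sup_norm x)"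
  have h: "h \<ge> 1" using x(1) by (simp add: h_def admissible_def)
  obtain i where i: "\<bar>x $ i\<bar> = int_sup_norm x" using int_sup_norm_attained by blast
  then have xi: "\<bar>real_of_int (x $ i)\<bar> = h" "x $ i \<noteq> 0" using h by (auto simp: h_def)
  \<comment> \<open>Changing column \<open>i\<close> of \<open>\<Theta>\<close> by \<open>v\<close> makes all the forms take the integer values \<open>y\<close> at \<open>x\<close>.
    As \<open>x $ i\<close> is the largest entry of \<open>x\<close>, the change is as small as possible.\<close>
  define y where "y j = round (lin_form \<Theta> x j)" for j
  define v where "v j = (of_int (y j) - lin_form \<Theta> x j) / of_int (x $ i)" for j
  define \<Phi> where "\<Phi> = \<Theta> + (\<chi> j. axis i (v j))"
  have \<Phi>: "lin_form \<Phi> x j = of_int (y j)" for j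
    unfolding \<Phi>_def lin_form_add_column using xi(2) by (simp add: v_def)
  have v: "\<bar>v j\<bar> \<le> e / h" for j
    using x(2)[of j] h unfolding v_def abs_divide xi(1)
    by (intro divide_right_mono) (auto simp: dist_nearest_int_def y_def abs_minus_commute)
  have dist\<Phi>: "dist \<Theta> \<Phi> \<le> real CARD('m) * (e / h)"
    using norm_column_le[OF v, of i] by (simp add: \<Phi>_def dist_norm)
  define d where "d = real (CARD('m) + 1) * (e / h)"
  define r where "r = a / (CARD('n) * real (CARD('m) + 1)) * d"
  have r: "r = a / real CARD('n) * (e / h)" 
  proof -
    have "a / (N * M) * (M * q) = a / N * q" if "M \<noteq> 0" for N M q :: real
      using that by simp
    from this[of "real (CARD('m) + 1)"] show ?thesis
      unfolding r_def d_def using of_nat_neq_0[of "CARD('m)"] by simp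
  qed
  have "a / CARD('n) \<le> 1 / 1" using a by (intro frac_le) auto
  then have "r \<le> 1 * (e / h)" unfolding r using e h by (intro mult_right_mono) auto
  then have r_le: "r \<le> e / h" by simp
  have "e / h \<le> e / 1" using e h by (intro divide_left_mono) auto
  then have "d \<le> real (CARD('m) + 1) * e" unfolding d_def by (intro mult_left_mono) auto
  moreover have "0 < d" using e h by (simp add: d_def)
  moreover have "ball \<Phi> r \<subseteq> ball \<Theta> d \<inter> {\<Psi>. irr_measure \<Psi> (real (k ^ CARD('m))) \<le> a * e}"
  proof (intro subsetI IntI CollectI)
    fix \<Psi> assume \<Psi>: "\<Psi> \<in> ball \<Phi> r"
    have "dist \<Theta> \<Psi> \<le> dist \<Theta> \<Phi> + dist \<Phi> \<Psi>" by (rule dist_triangle)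
    also have "\<dots> < real CARD('m) * (e / h) + e / h"
      using dist\<Phi> \<Psi> r_le by (intro add_le_less_mono) auto
    also have "\<dots> = d" by (simp add: d_def algebra_simps add_divide_distrib)
    finally show "\<Psi> \<in> ball \<Theta> d" by simp
    have "dist_nearest_int (lin_form \<Psi> x j) \<le> a * e" for j
    proof -
      have "dist_nearest_int (lin_form \<Psi> x j) \<le> \<bar>lin_form \<Psi> x j - of_int (y j)\<bar>"
        by (rule dist_nearest_int_le)
      also have "\<dots> = \<bar>lin_form (\<Psi> - \<Phi>) x j\<bar>" unfolding lin_form_diff \<Phi> ..
      also have "\<dots> \<le> CARD('n) * (norm (\<Psi> - \<Phi>) * h)" unfolding h_def by (rule abs_lin_form_le)
      also have "\<dots> \<le> CARD('n) * (r * h)"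
        using \<Psi> h by (intro mult_left_mono mult_right_mono) (auto simp: dist_norm norm_minus_commute)
      also have "\<dots> = a * e" using h by (simp add: r field_simps)
      finally show ?thesis .
    qed
    with x(1) show "irr_measure \<Psi> (real (k ^ CARD('m))) \<le> a * e"
      unfolding irr_measure_le_iff[OF t1] by blast
  qed
  ultimately show ?thesis unfolding r_def by (intro exI[of _ d] exI[of _ \<Phi>]) (simp add: e_def)
qed

text \<open>
  A set with holes of a fixed proportion at arbitrarily small scales around each of its points
  has no density points. The proof is a direct Vitali covering argument: inside an open set \<open>U\<close> that
  is only slightly larger than \<open>S\<close>, disjoint balls cover almost all of \<open>S\<close>, while their holes
  together have measure at most that of \<open>U - S\<close>.
\<close>
lemma porous_negligible:
  fixes S :: "'a::euclidean_space set"
  assumes S: "S \<in> sets lebesgue" and c: "c > 0"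
    and porous: "\<And>x e. x \<in> S \<Longrightarrow> e > 0 \<Longrightarrow> \<exists>d y. 0 < d \<and> d < e \<and> ball y (c * d) \<subseteq> ball x d - S"
  shows "negligible S"
proof -
  have small: "emeasure lebesgue S \<le> ennreal e" if e: "e > 0" for e
  proof -
    define q where "q = c ^ DIM('a)"
    have q: "q > 0" using c by (simp add: q_def)
    obtain U where U: "open U" "S \<subseteq> U" "U - S \<in> lmeasurable" "emeasure lebesgue (U - S) < ennreal (q * e)"
      using sets_lebesgue_outer_open[OF S, of "q * e"] q e by auto
    define K where "K = {(x, d, y). 0 < d \<and> ball x d \<subseteq> U \<and> ball y (c * d) \<subseteq> ball x d - S}"
    have "\<exists>i. i \<in> K \<and> x \<in> ball (fst i) (fst (snd i)) \<and> fst (snd i) < e" if x: "x \<in> S" and e: "e > 0" for x e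
    proof -
      obtain r where r: "r > 0" "ball x r \<subseteq> U"
        using U(1,2) x by (metis openE subsetD)
      obtain d y where d: "0 < d" "d < min r e" "ball y (c * d) \<subseteq> ball x d - S"
        using porous[OF x, of "min r e"] r e by auto
      moreover from this r have "ball x d \<subseteq> U"
        by (metis less_imp_le min_less_iff_conj order_trans subset_ball)
      ultimately have "(x, d, y) \<in> K" by (simp add: K_def)
      with d show ?thesis by force
    qed
    from Vitali_covering_theorem_balls[OF this] obtain C where
      C: "countable C" "C \<subseteq> K"
       "pairwise (\<lambda>i j. disjnt (ball (fst i) (fst (snd i))) (ball (fst j) (fst (snd j)))) C"
       "negligible (S - (\<Union>i\<in>C. ball (fst i) (fst (snd i))))"
      by blast
    define B where "B i = ball (fst i) (fst (snd i))" for i :: "'a \<times> real \<times> 'a"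
    define G where "G i = ball (snd (snd i)) (c * fst (snd i))" for i :: "'a \<times> real \<times> 'a"
    have GB: "G i \<subseteq> B i - S" and BU: "B i \<subseteq> U" and pos: "0 < fst (snd i)" if "i \<in> C" for i
      using C(2) that by (force simp: B_def G_def K_def)+
    have disjB: "disjoint_family_on B C"
      using C(3) by (auto simp: disjoint_family_on_def pairwise_def disjnt_def B_def)
    have disjG: "disjoint_family_on G C"
      using disjB GB unfolding disjoint_family_on_def by blast
    have [measurable]: "G i \<in> sets lebesgue" "B i \<in> sets lebesgue" for i
      by (auto simp: G_def B_def)
    have vol: "emeasure lebesgue (G i) = ennreal q * emeasure lebesgue (B i)" if "i \<in> C" for i
      using pos[OF that] c
      by (simp add: G_def B_def emeasure_ball q_def power_mult_distrib flip: ennreal_mult'')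
    \<comment> \<open>The union of the \<open>B i\<close> covers almost all of \<open>S\<close>, and the union of the \<open>G i\<close>, whose measure
      is \<open>q\<close> times as large, fits into \<open>U - S\<close>.\<close>
    have "ennreal q * emeasure lebesgue S \<le> ennreal q * emeasure lebesgue (\<Union>i\<in>C. B i)"
    proof (rule mult_left_mono)
      have V: "(\<Union>i\<in>C. B i) \<in> sets lebesgue" using C(1) by (intro sets.countable_UN') auto
      have "emeasure lebesgue S \<le> emeasure lebesgue ((\<Union>i\<in>C. B i) \<union> (S - (\<Union>i\<in>C. B i)))"
        using V S by (intro emeasure_mono) auto
      also have "\<dots> = emeasure lebesgue (\<Union>i\<in>C. B i)"
        using C(4) V by (intro emeasure_Un_null_set) (auto simp: B_def negligible_iff_null_sets)
      finally show "emeasure lebesgue S \<le> emeasure lebesgue (\<Union>i\<in>C. B i)" .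
    qed simp
    also have "\<dots> = (\<integral>\<^sup>+i. ennreal q * emeasure lebesgue (B i) \<partial>count_space C)"
      using C(1) disjB by (subst emeasure_UN_countable) (auto simp: nn_integral_cmult)
    also have "\<dots> = (\<integral>\<^sup>+i. emeasure lebesgue (G i) \<partial>count_space C)"
      by (intro nn_integral_cong) (metis vol space_count_space)
    also have "\<dots> = emeasure lebesgue (\<Union>i\<in>C. G i)"
      using C(1) disjG by (subst emeasure_UN_countable) auto
    also have "\<dots> \<le> emeasure lebesgue (U - S)"
    proof (rule emeasure_mono)
      show "(\<Union>i\<in>C. G i) \<subseteq> U - S"
      proof (rule UN_least)
        fix i assume "i \<in> C"
        from GB[OF this] BU[OF this] show "G i \<subseteq> U - S" by auto
      qed
      show "U - S \<in> sets lebesgue" using U(3) by (rule fmeasurableD)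
    qed
    also have "\<dots> \<le> ennreal q * ennreal e"
      using U(4) q e by (simp add: ennreal_mult)
    finally show ?thesis
      using q by (subst (asm) ennreal_mult_le_mult_iff) auto
  qed
  have "emeasure lebesgue S \<le> 0"
  proof (rule ennreal_le_epsilon)
    show "emeasure lebesgue S \<le> 0 + ennreal e" if "e > 0" for e
      unfolding add_0 by (rule small[OF that])
  qed
  then have "emeasure lebesgue S = 0" unfolding le_zero_eq .
  then show ?thesis unfolding negligible_iff_emeasure0[OF S] .
qed

lemma AE_lborel_iff_negligible:
  fixes P :: "'a::euclidean_space \<Rightarrow> bool"
  shows "(AE x in lborel. P x) \<longleftrightarrow> negligible {x. \<not> P x}"
proof -
  have "(AE x in lborel. P x) \<longleftrightarrow> (AE x in lebesgue. P x)" by (rule AE_completion_iff[symmetric])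
  also have "\<dots> \<longleftrightarrow> (\<exists>N. negligible N \<and> {x. \<not> P x} \<subseteq> N)"
    by (auto simp: eventually_ae_filter negligible_iff_null_sets)
  also have "\<dots> \<longleftrightarrow> negligible {x. \<not> P x}" by (meson negligible_subset order_refl)
  finally show ?thesis .
qed

text \<open>
  The freedom in \<open>K\<close> is what the comparison of two matrices needs: \<open>K\<close> will be the set of
  indices at which the measure function of the other matrix is large.
\<close>
lemma AE_irr_measure_le_infinitely_often:
  assumes K: "infinite K" and a: "0 < a" "a \<le> 1"
  shows "AE \<Theta> :: real ^ 'n::finite ^ 'm::finite in lborel.
    infinite {k \<in> K. irr_measure \<Theta> (real (Suc k ^ CARD('m))) \<le> a / real (Suc k) ^ CARD('n)}"
proof -
  define F where "F N = {\<Theta> :: real ^ 'n ^ 'm. \<forall>k\<in>K. N \<le> k \<longrightarrow>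
     a / real (Suc k) ^ CARD('n) < irr_measure \<Theta> (real (Suc k ^ CARD('m)))}" for N :: nat
  \<comment> \<open>The balls of \<open>ball_of_small_irr_measure\<close> for large \<open>k \<in> K\<close> are the holes that make \<open>F N\<close> porous.\<close>
  have "negligible (F N)" for N
  proof (rule porous_negligible)
    have "F N = (\<Inter>k\<in>K \<inter> {N..}. {\<Theta>. a / real (Suc k) ^ CARD('n) < irr_measure \<Theta> (real (Suc k ^ CARD('m)))})"
      by (auto simp: F_def)
    also have "\<dots> \<in> sets borel"
    proof (intro sets.countable_INT'')
      fix k
      show "{\<Theta> :: real ^ 'n ^ 'm. a / real (Suc k) ^ CARD('n) < irr_measure \<Theta> (real (Suc k ^ CARD('m)))} \<in> sets borel"
        using borel_measurable_less[OF borel_measurable_const borel_measurable_irr_measure_power] by simp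
    qed auto
    finally show "F N \<in> sets lebesgue" by auto
    show "0 < a / (CARD('n) * real (CARD('m) + 1))" using a by simp
    fix \<Theta> :: "real ^ 'n ^ 'm" and e :: real
    assume e: "e > 0"
    have "(\<lambda>k. real (CARD('m) + 1) / real (Suc k)) \<longlonglongrightarrow> 0"
      by (rule LIMSEQ_Suc) (rule lim_const_over_n)
    with e have "eventually (\<lambda>k. real (CARD('m) + 1) / real (Suc k) < e) sequentially"
      by (simp add: order_tendsto_iff)
    then obtain k0 where k0: "\<And>k. k \<ge> k0 \<Longrightarrow> real (CARD('m) + 1) / real (Suc k) < e"
      by (auto simp: eventually_sequentially)
    obtain k where k: "k \<in> K" "k \<ge> max k0 N"
      using K by (metis infinite_nat_iff_unbounded_le)
    obtain d \<Phi> where d: "0 < d" "d \<le> real (CARD('m) + 1) / real (Suc k) ^ CARD('n)"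
      "ball \<Phi> (a / (CARD('n) * real (CARD('m) + 1)) * d) \<subseteq>
       ball \<Theta> d \<inter> {\<Psi>. irr_measure \<Psi> (real (Suc k ^ CARD('m))) \<le> a / real (Suc k) ^ CARD('n)}"
      using ball_of_small_irr_measure[of "Suc k" a \<Theta>] a by auto
    have "real (Suc k) ^ 1 \<le> real (Suc k) ^ CARD('n)"
      by (rule power_increasing) auto
    then have "real (CARD('m) + 1) / real (Suc k) ^ CARD('n) \<le> real (CARD('m) + 1) / real (Suc k)"
      by (intro divide_left_mono) auto
    with d(2) k0[of k] k have "d < e" by auto
    moreover have "ball \<Phi> (a / (CARD('n) * real (CARD('m) + 1)) * d) \<subseteq> ball \<Theta> d - F N"
      using d(3) k by (force simp: F_def not_less)
    ultimately show "\<exists>d \<Phi>. 0 < d \<and> d < e \<and> ball \<Phi> (a / (CARD('n) * real (CARD('m) + 1)) * d) \<subseteq> ball \<Theta> d - F N"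
      using d(1) by blast
  qed
  then have "AE \<Theta> in lborel. \<forall>N. \<Theta> \<notin> F N"
    by (auto simp: AE_all_countable AE_lborel_iff_negligible)
  then show ?thesis
    by (rule eventually_mono) (auto simp: infinite_nat_iff_unbounded_le F_def not_less)
qed

section \<open>Singular matrices form a null set\<close>

text \<open>
  The shifts by multiples of \<open>3 * \<delta>\<close> of a \<open>\<delta>\<close>-neighbourhood of the integers are disjoint as long
  as they do not wrap around the circle.
\<close>
lemma dist_nearest_int_exclusive:
  assumes "dist_nearest_int u \<le> \<delta>" "dist_nearest_int v \<le> \<delta>" "0 < \<delta>"
    and "3 * \<delta> * real M \<le> 1" "k < M" "l < M" "u + 3 * \<delta> * real k = v + 3 * \<delta> * real l"
  shows "k = l"
proof -
  have no: False if "dist_nearest_int u \<le> \<delta>" "dist_nearest_int v \<le> \<delta>" "k < l" "l < M"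
    "u + 3 * \<delta> * real k = v + 3 * \<delta> * real l" for u v k l
  proof -
    define z where "z = round u - round v"
    have z: "\<bar>real_of_int z - 3 * \<delta> * real (l - k)\<bar> \<le> 2 * \<delta>"
      using that by (simp add: dist_nearest_int_def z_def of_nat_diff algebra_simps)
    have "3 * \<delta> * 1 \<le> 3 * \<delta> * real (l - k)"
      using that assms(3) by (intro mult_left_mono) auto
    moreover have "3 * \<delta> * real (l - k) \<le> 3 * \<delta> * (real M - 1)"
      using that assms(3) by (intro mult_left_mono) auto
    moreover have "3 * \<delta> * (real M - 1) \<le> 1 - 3 * \<delta>"
      using assms(4) by (simp add: algebra_simps)
    ultimately have "0 < real_of_int z" "real_of_int z < 1"
      using z assms(3) by linarith+
    then show False by simp
  qed
  show ?thesis
    using no[of u v k l] no[of v u l k] assms by (metis linorder_neqE_nat)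
qed

text \<open>
  Modulo 1 the values of the forms at a fixed \<open>x\<close> should be equidistributed, with probability of
  order \<open>\<delta> ^ m\<close> to be small. The upper bound follows from translation invariance alone: about
  \<open>(1 / (6 * \<delta>)) ^ m\<close> translates of the set in question are disjoint and lie in one ball. It matters
  that the bound is uniform in \<open>x\<close>.
\<close>
lemma measure_small_forms_le:
  fixes x :: "int ^ 'n::finite" and R :: real
  assumes x: "x \<noteq> 0" and \<delta>: "0 < \<delta>" "\<delta> \<le> 1 / 6"
  defines "S \<equiv> {\<Theta> :: real ^ 'n ^ 'm::finite. norm \<Theta> \<le> R \<and> (\<forall>j. dist_nearest_int (lin_form \<Theta> x j) \<le> \<delta>)}"
  shows "S \<in> lmeasurable"
    and "measure lebesgue S \<le> measure lebesgue (cball 0 (R + CARD('m)) :: (real ^ 'n ^ 'm) set) * (6 * \<delta>) ^ CARD('m)"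
proof -
  have "S = cball 0 R \<inter> (\<Inter>j. {\<Theta>. dist_nearest_int (lin_form \<Theta> x j) \<le> \<delta>})"
    by (auto simp: S_def)
  moreover have "(\<Inter>j. {\<Theta> :: real ^ 'n ^ 'm. dist_nearest_int (lin_form \<Theta> x j) \<le> \<delta>}) \<in> sets borel"
    by (rule sets.finite_INT) auto
  ultimately show S: "S \<in> lmeasurable"
    by (simp add: fmeasurable_Int_fmeasurable)
  obtain i where i: "x $ i \<noteq> 0" using x by (auto simp: vec_eq_iff)
  \<comment> \<open>Moving column \<open>i\<close> by \<open>w k\<close> shifts the value of form \<open>j\<close> at \<open>x\<close> by \<open>3 * \<delta> * k j\<close>, and
    \<open>M\<close> intervals of radius \<open>\<delta>\<close> whose centres are \<open>3 * \<delta>\<close> apart fit into a circle of length 1.\<close>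
  define M where "M = nat \<lfloor>1 / (3 * \<delta>)\<rfloor>"
  have "real M = of_int \<lfloor>1 / (3 * \<delta>)\<rfloor>" using \<delta> by (simp add: M_def)
  then have "real M \<le> 1 / (3 * \<delta>)" "1 / (3 * \<delta>) - 1 < real M" by linarith+
  moreover have "1 / (6 * \<delta>) \<le> 1 / (3 * \<delta>) - 1" using \<delta> by (simp add: field_simps)
  ultimately have M: "3 * \<delta> * real M \<le> 1" "1 \<le> 6 * \<delta> * real M"
    using \<delta> by (auto simp: field_simps)
  define I :: "('m \<Rightarrow> nat) set" where "I = (UNIV \<rightarrow>\<^sub>E {..<M})"
  define w where "w k = ((\<chi> j. axis i (3 * \<delta> * real (k j) / of_int (x $ i))) :: real ^ 'n ^ 'm)" for k
  have w: "lin_form (\<Theta> + w k) x j = lin_form \<Theta> x j + 3 * \<delta> * real (k j)" for \<Theta> k j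
    unfolding w_def lin_form_add_column using i by simp
  have disj: "disjnt ((+) (w k) ` S) ((+) (w l) ` S)" if kl: "k \<in> I" "l \<in> I" "k \<noteq> l" for k l
  proof -
    have False if "\<Theta> \<in> S" "\<Phi> \<in> S" "w k + \<Theta> = w l + \<Phi>" for \<Theta> \<Phi>
    proof -
      have "k j = l j" for j
      proof (rule dist_nearest_int_exclusive)
        show "dist_nearest_int (lin_form \<Theta> x j) \<le> \<delta>" "dist_nearest_int (lin_form \<Phi> x j) \<le> \<delta>"
          using that by (auto simp: S_def)
        show "k j < M" "l j < M" using kl by (auto simp: I_def PiE_def Pi_def)
        show "lin_form \<Theta> x j + 3 * \<delta> * real (k j) = lin_form \<Phi> x j + 3 * \<delta> * real (l j)"
          using that(3) by (metis w add.commute)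
      qed (use \<delta> M in auto)
      with kl(3) show False by auto
    qed
    then show ?thesis by (auto simp: disjnt_def)
  qed
  have fin: "finite I" unfolding I_def by (intro finite_PiE) auto
  have "real M ^ CARD('m) * measure lebesgue S = (\<Sum>k\<in>I. measure lebesgue ((+) (w k) ` S))"
    by (simp add: measure_translation I_def card_PiE)
  also have "\<dots> = measure lebesgue (\<Union>k\<in>I. (+) (w k) ` S)"
    using fin disj S by (intro measure_UNION'[symmetric]) (auto simp: measurable_translation pairwise_def)
  also have "\<dots> \<le> measure lebesgue (cball 0 (R + CARD('m)) :: (real ^ 'n ^ 'm) set)"
  proof (rule measure_mono_fmeasurable)
    show "(\<Union>k\<in>I. (+) (w k) ` S) \<subseteq> cball 0 (R + CARD('m))"
    proof clarify
      fix k \<Theta> assume k: "k \<in> I" and \<Theta>: "\<Theta> \<in> S"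
      have "norm (w k) \<le> real CARD('m) * 1"
        unfolding w_def
      proof (rule norm_column_le)
        fix j
        have "3 * \<delta> * real (k j) \<le> 3 * \<delta> * real M"
          using k \<delta> by (intro mult_left_mono) (auto simp: I_def PiE_def Pi_def less_imp_le)
        then have "3 * \<delta> * real (k j) \<le> 1" using M by linarith
        moreover have "1 \<le> \<bar>real_of_int (x $ i)\<bar>" using i by linarith
        ultimately show "\<bar>3 * \<delta> * real (k j) / of_int (x $ i)\<bar> \<le> 1"
          using \<delta> by (simp add: abs_mult field_simps)
      qed
      then show "w k + \<Theta> \<in> cball 0 (R + CARD('m))"
        using \<Theta> norm_triangle_ineq[of "w k" \<Theta>] by (auto simp: S_def)
    qed
    show "(\<Union>k\<in>I. (+) (w k) ` S) \<in> sets lebesgue"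
      using fin S by (intro sets.finite_UN) (auto intro: fmeasurableD measurable_translation)
  qed auto
  finally have bound: "real M ^ CARD('m) * measure lebesgue S \<le> measure lebesgue (cball 0 (R + CARD('m)) :: (real ^ 'n ^ 'm) set)" .
  have "measure lebesgue S = 1 * measure lebesgue S" by simp
  also have "\<dots> \<le> (6 * \<delta> * real M) ^ CARD('m) * measure lebesgue S"
    using M by (intro mult_right_mono one_le_power) auto
  also have "\<dots> = (6 * \<delta>) ^ CARD('m) * (real M ^ CARD('m) * measure lebesgue S)"
    by (simp add: power_mult_distrib)
  also have "\<dots> \<le> (6 * \<delta>) ^ CARD('m) * measure lebesgue (cball 0 (R + CARD('m)) :: (real ^ 'n ^ 'm) set)"
    using bound \<delta> by (intro mult_left_mono) auto
  finally show "measure lebesgue S \<le> measure lebesgue (cball 0 (R + CARD('m)) :: (real ^ 'n ^ 'm) set) * (6 * \<delta>) ^ CARD('m)"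
    by (simp add: mult.commute)
qed

lemma card_admissible_le: "card (admissible (real H) :: (int ^ 'n::finite) set) \<le> (2 * H + 1) ^ CARD('n)"
proof -
  let ?A = "UNIV \<rightarrow>\<^sub>E {- int H..int H} :: ('n \<Rightarrow> int) set"
  have fin: "finite ?A" by (intro finite_PiE) auto
  have "(admissible (real H) :: (int ^ 'n) set) \<subseteq> vec_lambda ` ?A"
  proof
    fix x :: "int ^ 'n"
    assume "x \<in> admissible (real H)"
    then have "int_sup_norm x \<le> int H" by (simp add: admissible_def)
    then have "\<bar>x $ i\<bar> \<le> int H" for i
      using abs_le_int_sup_norm[of x i] by linarith
    then have "vec_nth x \<in> ?A" by (auto simp: PiE_def Pi_def abs_le_iff minus_le_iff)
    then show "x \<in> vec_lambda ` ?A" by (intro image_eqI[of _ _ "vec_nth x"]) auto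
  qed
  then have "card (admissible (real H) :: (int ^ 'n) set) \<le> card (vec_lambda ` ?A :: (int ^ 'n) set)"
    using fin by (intro card_mono) auto
  also have "\<dots> \<le> card ?A" using fin by (rule card_image_le)
  also have "\<dots> = (2 * H + 1) ^ CARD('n)" by (simp add: card_PiE nat_add_distrib nat_mult_distrib)
  finally show ?thesis .
qed

text \<open>
  A union bound over the \<open>O(k ^ (m * n))\<close> admissible vectors; the factor \<open>(1 / k ^ n) ^ m\<close> in the
  bound for one vector cancels their number, so that the result does not depend on \<open>k\<close>.
\<close>
lemma measure_small_irr_measure_le:
  fixes R a :: real
  assumes a: "0 < a" "a \<le> 1 / 6" and k: "k > 0"
  defines "G \<equiv> {\<Theta> :: real ^ 'n::finite ^ 'm::finite. norm \<Theta> \<le> R \<and> irr_measure \<Theta> (real (k ^ CARD('m))) \<le> a / real k ^ CARD('n)}"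
  shows "G \<in> lmeasurable"
    and "measure lebesgue G \<le> 3 ^ CARD('n) * measure lebesgue (cball 0 (R + CARD('m)) :: (real ^ 'n ^ 'm) set) * (6 * a) ^ CARD('m)"
proof -
  define V where "V = measure lebesgue (cball 0 (R + CARD('m)) :: (real ^ 'n ^ 'm) set)"
  define \<delta> where "\<delta> = a / real k ^ CARD('n)"
  define A :: "(int ^ 'n) set" where "A = admissible (real (k ^ CARD('m)))"
  define S where "S x = {\<Theta> :: real ^ 'n ^ 'm. norm \<Theta> \<le> R \<and> (\<forall>j. dist_nearest_int (lin_form \<Theta> x j) \<le> \<delta>)}" for x
  have finA: "finite A" unfolding A_def by (rule finite_admissible)
  have "1 \<le> real k ^ CARD('n)" using k by simp
  then have "a / real k ^ CARD('n) \<le> a / 1" using a k by (intro divide_left_mono) auto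
  then have "\<delta> \<le> 1 / 6" unfolding \<delta>_def using a by linarith
  moreover have "0 < \<delta>" using a k by (simp add: \<delta>_def)
  ultimately have \<delta>: "0 < \<delta>" "\<delta> \<le> 1 / 6" by auto
  have t1: "1 \<le> real (k ^ CARD('m))" using k by simp
  have G: "G = (\<Union>x\<in>A. S x)"
    unfolding G_def S_def A_def irr_measure_le_iff[OF t1] \<delta>_def by blast
  have nz: "x \<noteq> 0" if "x \<in> A" for x
    using that by (auto simp: A_def admissible_def int_sup_norm_def)
  have S: "S x \<in> lmeasurable" "measure lebesgue (S x) \<le> V * (6 * \<delta>) ^ CARD('m)" if "x \<in> A" for x
    unfolding S_def V_def using measure_small_forms_le[OF nz[OF that] \<delta>, where R = R and 'm = 'm] by auto
  show "G \<in> lmeasurable" unfolding G using finA S(1) by (intro fmeasurable.finite_UN) auto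
  have "measure lebesgue G \<le> (\<Sum>x\<in>A. measure lebesgue (S x))"
    unfolding G using finA S(1) by (intro measure_UNION_le) (auto intro: fmeasurableD)
  also have "\<dots> \<le> (\<Sum>x\<in>A. V * (6 * \<delta>) ^ CARD('m))" by (intro sum_mono S(2))
  also have "\<dots> = real (card A) * (V * (6 * \<delta>) ^ CARD('m))" by simp
  also have "\<dots> \<le> real ((3 * k ^ CARD('m)) ^ CARD('n)) * (V * (6 * \<delta>) ^ CARD('m))"
  proof (intro mult_right_mono of_nat_mono)
    have "card A \<le> (2 * k ^ CARD('m) + 1) ^ CARD('n)" unfolding A_def by (rule card_admissible_le)
    also have "\<dots> \<le> (3 * k ^ CARD('m)) ^ CARD('n)"
      using k by (intro power_mono) (auto simp: Suc_le_eq)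
    finally show "card A \<le> (3 * k ^ CARD('m)) ^ CARD('n)" .
  qed (use \<delta> in \<open>auto simp: V_def\<close>)
  also have "\<dots> = 3 ^ CARD('n) * V * (6 * a) ^ CARD('m)"
    using k by (simp add: \<delta>_def power_mult_distrib power_divide mult.commute flip: power_mult)
  finally show "measure lebesgue G \<le> 3 ^ CARD('n) * measure lebesgue (cball 0 (R + CARD('m)) :: (real ^ 'n ^ 'm) set) * (6 * a) ^ CARD('m)"
    by (simp add: V_def)
qed

text \<open>
  The set of singular matrices, along the heights \<open>(k + 1) ^ m\<close>. The constant \<open>a\<close> at which the
  bound fails is allowed to depend on the matrix; intersecting over all \<open>a\<close> turns the estimate
  \<open>O(a ^ m)\<close> into measure zero, without any zero-one law.
\<close>
lemma negligible_uniformly_small_irr_measure: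
  "negligible {\<Theta> :: real ^ 'n::finite ^ 'm::finite. \<forall>a. 0 < a \<and> a \<le> 1 \<longrightarrow>
     finite {k. a / real (Suc k) ^ CARD('n) < irr_measure \<Theta> (real (Suc k ^ CARD('m)))}}"
    (is "negligible ?Z")
proof -
  have "negligible (?Z \<inter> {\<Theta>. norm \<Theta> \<le> real R})" for R
    unfolding negligible_outer_le
  proof (intro allI impI)
    fix e :: real assume e: "e > 0"
    define C where "C = 3 ^ CARD('n) * measure lebesgue (cball 0 (real R + CARD('m)) :: (real ^ 'n ^ 'm) set) * 6"
    have C: "C \<ge> 0" by (simp add: C_def)
    define a where "a = min (1 / 6) (e / (C + 1))"
    have a: "0 < a" "a \<le> 1 / 6" "a \<le> e / (C + 1)"
      using e C unfolding a_def by (auto simp only: min.cobounded1 min.cobounded2 min_less_iff_conj) auto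
    define G where "G k = {\<Theta> :: real ^ 'n ^ 'm. norm \<Theta> \<le> real R \<and>
       irr_measure \<Theta> (real (Suc k ^ CARD('m))) \<le> a / real (Suc k) ^ CARD('n)}" for k
    have G: "G k \<in> lmeasurable" "measure lebesgue (G k) \<le> e" for k
    proof -
      show "G k \<in> lmeasurable"
        unfolding G_def by (rule measure_small_irr_measure_le(1)[OF a(1,2)]) simp
      have "measure lebesgue (G k) \<le> 3 ^ CARD('n) * measure lebesgue (cball 0 (real R + CARD('m)) :: (real ^ 'n ^ 'm) set) * (6 * a) ^ CARD('m)"
        unfolding G_def by (rule measure_small_irr_measure_le(2)[OF a(1,2)]) simp
      also have "\<dots> \<le> 3 ^ CARD('n) * measure lebesgue (cball 0 (real R + CARD('m)) :: (real ^ 'n ^ 'm) set) * (6 * a) ^ 1"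
        using a by (intro mult_left_mono power_decreasing) auto
      also have "\<dots> = C * a" by (simp add: C_def)
      also have "\<dots> \<le> (C + 1) * (e / (C + 1))" using a C by (intro mult_mono) auto
      also have "\<dots> = e" using C by simp
      finally show "measure lebesgue (G k) \<le> e" .
    qed
    \<comment> \<open>The matrices whose measure function stays small from \<open>N\<close> on lie in \<open>G N\<close> alone, which
      bounds them independently of \<open>N\<close>.\<close>
    define H where "H N = (\<Inter>k\<in>{N..}. G k)" for N
    have H: "H N \<in> lmeasurable" "measure lebesgue (H N) \<le> e" for N
    proof -
      have sub: "H N \<subseteq> G N" by (auto simp: H_def)
      have sets: "H N \<in> sets lebesgue"
        unfolding H_def using G(1) by (intro sets.countable_INT'') (auto intro: fmeasurableD)
      show "H N \<in> lmeasurable" by (rule fmeasurableI2[OF G(1) sub sets])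
      show "measure lebesgue (H N) \<le> e"
        using measure_mono_fmeasurable[OF sub sets G(1)] G(2)[of N] by linarith
    qed
    have incr: "H N \<subseteq> H (Suc N)" for N by (auto simp: H_def)
    have "(\<Union>N. H N) \<in> lmeasurable" by (rule measurable_nested_Union[where S = H, OF H incr])
    moreover have "measure lebesgue (\<Union>N. H N) \<le> e"
      by (rule LIMSEQ_le_const2[OF measure_nested_Union[where S = H, OF H incr]]) (use H(2) in auto)
    moreover have "?Z \<inter> {\<Theta>. norm \<Theta> \<le> real R} \<subseteq> (\<Union>N. H N)"
    proof clarify
      fix \<Theta> :: "real ^ 'n ^ 'm"
      assume "\<forall>a. 0 < a \<and> a \<le> 1 \<longrightarrow>
        finite {k. a / real (Suc k) ^ CARD('n) < irr_measure \<Theta> (real (Suc k ^ CARD('m)))}"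
      then have "finite {k. a / real (Suc k) ^ CARD('n) < irr_measure \<Theta> (real (Suc k ^ CARD('m)))}"
        using a by auto
      then obtain N where N: "\<And>k. a / real (Suc k) ^ CARD('n) < irr_measure \<Theta> (real (Suc k ^ CARD('m))) \<Longrightarrow> k < N"
        unfolding finite_nat_set_iff_bounded mem_Collect_eq Ball_def by blast
      have "irr_measure \<Theta> (real (Suc k ^ CARD('m))) \<le> a / real (Suc k) ^ CARD('n)" if "k \<ge> N" for k
        using N[of k] that by (meson leD not_less)
      moreover assume "norm \<Theta> \<le> real R"
      ultimately have "\<Theta> \<in> H N" by (auto simp: H_def G_def)
      then show "\<Theta> \<in> (\<Union>N. H N)" by blast
    qed
    ultimately show "\<exists>T. ?Z \<inter> {\<Theta>. norm \<Theta> \<le> real R} \<subseteq> T \<and> T \<in> lmeasurable \<and> measure lebesgue T \<le> e"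
      by blast
  qed
  then have "negligible (\<Union>R::nat. ?Z \<inter> {\<Theta>. norm \<Theta> \<le> real R})"
    by (rule negligible_Union_nat)
  moreover have "?Z \<subseteq> (\<Union>R::nat. ?Z \<inter> {\<Theta>. norm \<Theta> \<le> real R})"
    using real_arch_simple by blast
  ultimately show ?thesis by (rule negligible_subset)
qed

lemma AE_irr_measure_gt_infinitely_often:
  "AE \<Theta> :: real ^ 'n::finite ^ 'm::finite in lborel. \<exists>a>0. a \<le> 1 \<and>
     infinite {k. a / real (Suc k) ^ CARD('n) < irr_measure \<Theta> (real (Suc k ^ CARD('m)))}"
  unfolding AE_lborel_iff_negligible
  by (rule negligible_subset[OF negligible_uniformly_small_irr_measure]) blast

section \<open>Comparison of two matrices\<close>

text \<open>
  Fix the matrix whose measure function is to be the larger one; its large values determine the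
  constant \<open>a\<close> and the index set \<open>K\<close> for the other matrix. Fubini's theorem passes from almost all
  sections to almost all pairs.
\<close>
lemma AE_pair_irr_measure_less:
  fixes P :: "real ^ 'n::finite ^ 'm::finite \<Rightarrow> real ^ 'n ^ 'm \<Rightarrow> bool"
  defines "P \<equiv> (\<lambda>\<Theta> \<Theta>'. infinite {k. irr_measure \<Theta>' (real (Suc k ^ CARD('m))) < irr_measure \<Theta> (real (Suc k ^ CARD('m)))})"
  shows "AE p in lborel. P (fst p) (snd p)" "AE p in lborel. P (snd p) (fst p)"
proof -
  have P_alt: "P \<Theta> \<Theta>' \<longleftrightarrow> (\<forall>N. \<exists>k\<ge>N. irr_measure \<Theta>' (real (Suc k ^ CARD('m))) < irr_measure \<Theta> (real (Suc k ^ CARD('m))))" for \<Theta> \<Theta>'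
    by (simp add: P_def infinite_nat_iff_unbounded_le)
  have AE: "AE \<Theta> in lborel. AE \<Theta>' in lborel. P \<Theta> \<Theta>'"
    using AE_irr_measure_gt_infinitely_often
  proof (rule eventually_mono)
    fix \<Theta> :: "real ^ 'n ^ 'm"
    assume "\<exists>a>0. a \<le> 1 \<and> infinite {k. a / real (Suc k) ^ CARD('n) < irr_measure \<Theta> (real (Suc k ^ CARD('m)))}"
    then obtain a where a: "0 < a" "a \<le> 1"
      and inf: "infinite {k. a / real (Suc k) ^ CARD('n) < irr_measure \<Theta> (real (Suc k ^ CARD('m)))}"
      by blast
    show "AE \<Theta>' in lborel. P \<Theta> \<Theta>'"
      using AE_irr_measure_le_infinitely_often[OF inf a]
      by (rule eventually_mono) (auto simp: P_def elim!: infinite_super[rotated])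
  qed
  have [measurable]: "(\<lambda>p :: (real ^ 'n ^ 'm) \<times> (real ^ 'n ^ 'm). irr_measure (fst p) (real (Suc k ^ CARD('m)))) \<in> borel_measurable (lborel \<Otimes>\<^sub>M lborel)"
    "(\<lambda>p :: (real ^ 'n ^ 'm) \<times> (real ^ 'n ^ 'm). irr_measure (snd p) (real (Suc k ^ CARD('m)))) \<in> borel_measurable (lborel \<Otimes>\<^sub>M lborel)" for k
    by (rule measurable_compose[OF _ borel_measurable_irr_measure_power]; simp)+
  have meas: "{p \<in> space (lborel \<Otimes>\<^sub>M lborel). P (fst p) (snd p)} \<in> sets (lborel \<Otimes>\<^sub>M lborel)"
    "{p \<in> space (lborel \<Otimes>\<^sub>M lborel). P (snd p) (fst p)} \<in> sets (lborel \<Otimes>\<^sub>M lborel)"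
    unfolding P_alt by measurable
  have "AE p in lborel \<Otimes>\<^sub>M lborel. P (fst p) (snd p)"
    using lborel_pair.AE_pair_measure[OF meas(1)] AE by simp
  then show "AE p in lborel. P (fst p) (snd p)" by (simp only: lborel_prod)
  have "AE \<Theta> in lborel. AE \<Theta>' in lborel. P \<Theta>' \<Theta>"
    using AE lborel_pair.AE_commute[OF meas(1)] by simp
  then have "AE p in lborel \<Otimes>\<^sub>M lborel. P (snd p) (fst p)"
    using lborel_pair.AE_pair_measure[OF meas(2)] by simp
  then show "AE p in lborel. P (snd p) (fst p)" by (simp only: lborel_prod)
qed

lemma arbitrarily_large_powers:
  assumes "infinite {k. Q (real (Suc k ^ m))}" "m > 0"
  shows "\<exists>t. 1 \<le> t \<and> T < t \<and> Q t"
proof -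
  obtain k where k: "k \<ge> nat \<lceil>T\<rceil>" "Q (real (Suc k ^ m))"
    using assms(1) unfolding infinite_nat_iff_unbounded_le by blast
  have "real (Suc k) ^ 1 \<le> real (Suc k) ^ m"
    using assms(2) by (intro power_increasing) auto
  moreover have "T < real (Suc k)" using k(1) by linarith
  ultimately have "T < real (Suc k ^ m)" "1 \<le> real (Suc k ^ m)" by simp_all
  with k show ?thesis by blast
qed

theorem mainTheorem1:
  assumes "(CARD('m::finite) = 1 \<and> CARD('n::finite) = 2) \<or> (CARD('m) \<ge> 2 \<and> CARD('n) = 1)"
  shows "AE (\<Theta>, \<Theta>') in (lebesgue :: ((real ^ 'n ^ 'm) \<times> (real ^ 'n ^ 'm)) measure).
           \<forall>T>0. \<exists>t1 t2. 1 \<le> t1 \<and> T < t1 \<and> 1 \<le> t2 \<and> T < t2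
             \<and> irr_measure \<Theta> t1 - irr_measure \<Theta>' t1 > 0
             \<and> irr_measure \<Theta> t2 - irr_measure \<Theta>' t2 < 0"
  unfolding AE_completion_iff
  using AE_pair_irr_measure_less
proof eventually_elim
  case (elim p)
  obtain \<Theta> \<Theta>' where p: "p = (\<Theta>, \<Theta>')" by fastforce
  have "\<exists>t. 1 \<le> t \<and> T < t \<and> irr_measure \<Theta>' t < irr_measure \<Theta> t"
    "\<exists>t. 1 \<le> t \<and> T < t \<and> irr_measure \<Theta> t < irr_measure \<Theta>' t" for T
    using elim unfolding p by (auto intro!: arbitrarily_large_powers[where m = "CARD('m)"])
  then show ?case unfolding p by (auto; meson)
qed

end
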